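(* A finite graph $G$ is a Blanche Descartes graph if and only if every induced subgraph of $G$ contains a non-empty strongly splitting stable set.
   Context: Blanche Descartes construction: $D_1$ is the one-vertex graph; if $D_k$ has been constructed and has $n$ vertices, $D_{k+1}$ is obtained by taking a stable set $S$ of $k(n-1)+1$ new vertices and, for each $n$-element subset $T$ of $S$, adding a new copy of $D_k$ together with a perfect matching between $T$ and the vertices of that copy (the matchings may be chosen arbitrarily). A Blanche Descartes graph is any graph isomorphic to an induced subgraph of some graph obtained after $k$ steps of this construction, for some $k\ge 1$. A stable set $S$ of a graph $G$ is strongly splitting if every vertex of $S$ has at most one neighbor in each connected component of $G\setminus S$, and every vertex of $G\setminus S$ has at most one neighbor in $S$. Induced subgraphs are taken on non-empty vertex sets. *)

theory Defs
  imports "Graph_Theory.Digraph_Component" "Graph_Theory.Digraph_Isomorphism" "HOL-Library.Disjoint_Sets"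
begin

text \<open>
  A finite simple graph is a \<open>pair_graph\<close>: a finite, loop-free, symmetric digraph without parallel
  arcs, so that an undirected edge \<open>uv\<close> is the pair of arcs \<open>(u, v)\<close> and \<open>(v, u)\<close>.
\<close>

definition stable_set :: "('a, 'b) pre_digraph \<Rightarrow> 'a set \<Rightarrow> bool" where
  "stable_set G S \<longleftrightarrow> S \<subseteq> verts G \<and> (\<forall>u\<in>S. \<forall>v\<in>S. \<not> u \<rightarrow>\<^bsub>G\<^esub> v)"

definition connected_component :: "('a, 'b) pre_digraph \<Rightarrow> ('a, 'b) pre_digraph \<Rightarrow> bool" where
  "connected_component G C \<longleftrightarrow> pre_digraph.max_subgraph G connected C"

definition strongly_splitting :: "('a, 'b) pre_digraph \<Rightarrow> 'a set \<Rightarrow> bool" where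
  "strongly_splitting G S \<longleftrightarrow> stable_set G S
    \<and> (\<forall>v\<in>S. \<forall>C. connected_component (G \<restriction> (verts G - S)) C
          \<longrightarrow> (\<exists>\<^sub>\<le>\<^sub>1u. u \<in> verts C \<and> v \<rightarrow>\<^bsub>G\<^esub> u))
    \<and> (\<forall>v\<in>verts G - S. \<exists>\<^sub>\<le>\<^sub>1u. u \<in> S \<and> v \<rightarrow>\<^bsub>G\<^esub> u)"

text \<open>
  \<open>descartes k D\<close> means that \<open>D\<close> is a possible outcome \<open>D\<^sub>k\<close> of the construction. The construction
  involves choices (the matchings), so it is a relation. The type of natural numbers only serves as a
  supply of vertices. In the successor step, \<open>C T\<close> is the copy of \<open>D\<close> attached to the \<open>n\<close>-element
  subset \<open>T\<close> of \<open>S\<close>, and the bijection \<open>m T\<close> is the perfect matching between \<open>T\<close> and this copy.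
\<close>

inductive descartes :: "nat \<Rightarrow> nat pair_pre_digraph \<Rightarrow> bool" where
  one: "descartes 1 \<lparr> pverts = {v}, parcs = {} \<rparr>"
| step: "descartes (Suc k)
      \<lparr> pverts = S \<union> (\<Union>T\<in>\<T>. pverts (C T)),
        parcs = (\<Union>T\<in>\<T>. parcs (C T) \<union> (\<Union>t\<in>T. {(t, m T t), (m T t, t)})) \<rparr>"
  if "descartes k D" and "n = card (pverts D)"
    and "finite S" and "card S = k * (n - 1) + 1"
    and "\<T> = {T. T \<subseteq> S \<and> card T = n}"
    and "\<forall>T\<in>\<T>. digraph_iso (with_proj D) (with_proj (C T))"
    and "\<forall>T\<in>\<T>. pverts (C T) \<inter> S = {}"
    and "disjoint_family_on (\<lambda>T. pverts (C T)) \<T>"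
    and "\<forall>T\<in>\<T>. bij_betw (m T) T (pverts (C T))"

definition blanche_descartes :: "'a pair_pre_digraph \<Rightarrow> bool" where
  "blanche_descartes G \<longleftrightarrow> (\<exists>k\<ge>1. \<exists>D H. descartes k D
    \<and> induced_subgraph H (with_proj D) \<and> verts H \<noteq> {}
    \<and> digraph_iso (with_proj G) H)"

end

theory Submission
  imports Defs "HOL-Library.Nat_Bijection"
begin

text \<open>
  In \<open>D\<^sub>k\<^sub>+\<^sub>1\<close> the new stable set is strongly splitting, so an induced subgraph that meets it is split by
  the intersection; otherwise a splitting set of the part inside one copy of \<open>D\<^sub>k\<close> is splitting for
  the whole subgraph.

  Conversely, let \<open>S\<close> be a strongly splitting stable set of \<open>G\<close>. By induction \<open>G \<setminus> S\<close> (with all its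
  components at once) embeds into some \<open>D\<^sub>k\<close>, and raising the level makes both \<open>k\<close> and
  \<open>n = |D\<^sub>k|\<close> large compared with \<open>|G|\<close>. In \<open>D\<^sub>k\<^sub>+\<^sub>1\<close> map \<open>S\<close> injectively into the new stable set and give the
  \<open>i\<close>-th component its own copy of \<open>D\<^sub>k\<close>, attached to the set \<open>T\<^sub>i\<close> consisting of the images of the neighbours of
  that component and of filler vertices from a block reserved for \<open>i\<close>. Since the edges between \<open>S\<close>
  and a component form a partial matching, the matching at \<open>T\<^sub>i\<close> can be chosen to extend it.
\<close>

section \<open>Strongly splitting sets and embeddings\<close>

text \<open>Replaces components by reachability. Connectedness is strong connectedness of the
  symmetric closure, and closing a symmetric digraph leaves reachability unchanged. Hence the
  vertices reachable from \<open>a\<close> induce a strongly connected component, which is also a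
  maximal connected subgraph.\<close>

lemma (in sym_digraph) in_common_component_iff:
  "(\<exists>C. connected_component G C \<and> a \<in> verts C \<and> b \<in> verts C) \<longleftrightarrow> a \<rightarrow>\<^sup>* b"
proof
  have sub: "x \<rightarrow>\<^sup>* y" if "subgraph C G" "connected C" "x \<in> verts C" "y \<in> verts C" for C x y
  proof -
    have "x \<rightarrow>\<^sup>*\<^bsub>mk_symmetric C\<^esub> y"
      using that by (auto simp: connected_def strongly_connected_def)
    then have "x \<rightarrow>\<^sup>*\<^bsub>mk_symmetric G\<^esub> y"
      using subgraph_mk_symmetric[OF that(1)] by (rule pre_digraph.reachable_mono)
    then show ?thesis
      by (simp only: reachable_mk_symmetric_eq[OF sym_arcs])
  qed
  show "a \<rightarrow>\<^sup>* b" if "\<exists>C. connected_component G C \<and> a \<in> verts C \<and> b \<in> verts C"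
    using that sub by (auto simp: connected_component_def max_subgraph_def)
  assume ab: "a \<rightarrow>\<^sup>* b"
  then have a: "a \<in> verts G" by (rule reachable_in_verts)
  define C where "C = G \<restriction> {v. a \<rightarrow>\<^sup>* v}"
  have scc: "C \<in> sccs"
    unfolding C_def by (rule induce_reachable_is_in_sccs[OF a])
  then have ind: "induced_subgraph C G" and sc: "strongly_connected C"
    by (auto simp: sccs_def)
  then have conn: "connected C"
    using wf_digraph.connectedI wf_digraph.reachable_mk_symmetricI wf_digraphI_induced
    unfolding strongly_connected_def by metis
  \<comment> \<open>Maximality: a connected \<open>H'\<close> above \<open>C\<close> contains only
    vertices reachable from \<open>a\<close>, so it adds no vertex, and no arc either because
    \<open>C\<close> is induced.\<close>
  have "H' = C" if H': "subgraph C H'" "subgraph H' G" "connected H'" for H'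
  proof -
    have "a \<in> verts C" using a by (simp add: C_def)
    then have "a \<in> verts H'" using H'(1) by (auto simp: subgraph_def)
    then have "verts H' \<subseteq> verts C"
      using sub[OF H'(2,3)] by (auto simp: C_def)
    moreover have "arcs H' \<subseteq> {e \<in> arcs G. tail G e \<in> verts H' \<and> head G e \<in> verts H'}"
      using H'(2) wf_digraph.wellformed[of H']
      by (auto simp: subgraph_def compatible_def)
    moreover have "verts C \<subseteq> verts H'" "arcs C \<subseteq> arcs H'"
      using H'(1) by (auto simp: subgraph_def)
    ultimately have "verts H' = verts C" "arcs H' = arcs C"
      using ind by (auto simp: induced_subgraph_def)
    moreover have "tail H' = tail C" "head H' = head C"
      using H'(1) by (auto simp: subgraph_def compatible_def)
    ultimately show ?thesis by simp
  qed
  then have "connected_component G C"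
    using ind conn by (auto simp: connected_component_def max_subgraph_def)
  moreover have "a \<in> verts C" "b \<in> verts C" using a ab by (auto simp: C_def)
  ultimately show "\<exists>C. connected_component G C \<and> a \<in> verts C \<and> b \<in> verts C" by blast
qed

text \<open>The set \<open>W\<close> stands for the subgraph that it induces.\<close>

definition splits :: "'a rel \<Rightarrow> 'a set \<Rightarrow> 'a set \<Rightarrow> bool" where
  "splits E W S \<longleftrightarrow> S \<subseteq> W \<and> (\<forall>u\<in>S. \<forall>v\<in>S. (u, v) \<notin> E)
    \<and> (\<forall>v\<in>S. \<forall>a\<in>W - S. \<forall>b\<in>W - S.
        (v, a) \<in> E \<longrightarrow> (v, b) \<in> E \<longrightarrow> (a, b) \<in> (Restr E (W - S))\<^sup>* \<longrightarrow> a = b)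
    \<and> (\<forall>v\<in>W - S. \<forall>s\<in>S. \<forall>t\<in>S. (v, s) \<in> E \<longrightarrow> (v, t) \<in> E \<longrightarrow> s = t)"

definition hereditarily_split :: "'a rel \<Rightarrow> 'a set \<Rightarrow> bool" where
  "hereditarily_split E V \<longleftrightarrow> (\<forall>W\<subseteq>V. W \<noteq> {} \<longrightarrow> (\<exists>S. S \<noteq> {} \<and> splits E W S))"

text \<open>At most one neighbour per component means that two neighbours joined by a path in
  \<open>W - S\<close> coincide, which is how \<open>splits\<close> avoids components
  altogether.\<close>

lemma (in pair_sym_digraph) strongly_splitting_induce_iff:
  assumes "W \<subseteq> pverts G"
  shows "strongly_splitting (with_proj G \<restriction> W) S \<longleftrightarrow> splits (parcs G) W S"
proof -
  have adj: "u \<rightarrow>\<^bsub>with_proj G \<restriction> X\<^esub> v \<longleftrightarrow> (u, v) \<in> Restr (parcs G) X" for u v X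
    by (auto simp: arcs_ends_conv image_iff)
  have adjs: "arcs_ends (with_proj G \<restriction> X) = Restr (parcs G) X" for X
    using adj by auto
  have common: "(\<exists>C. connected_component (with_proj G \<restriction> X) C \<and> a \<in> verts C \<and> b \<in> verts C)
      \<longleftrightarrow> a \<in> X \<and> b \<in> X \<and> (a, b) \<in> (Restr (parcs G) X)\<^sup>*" if X: "X \<subseteq> pverts G" for X a b
  proof -
    have "induced_subgraph (with_proj G \<restriction> X) (with_proj G)"
      using X by (intro induced_induce) auto
    then interpret X: sym_digraph "with_proj G \<restriction> X"
      by (rule induced_graph_imp_graph)
    show ?thesis
      unfolding X.in_common_component_iff X.reachable_conv adjs by auto
  qed
  have ind: "(with_proj G \<restriction> W) \<restriction> (W - S) = with_proj G \<restriction> (W - S)"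
    by (auto simp: induce_subgraph_def)
  have WS: "W - S \<subseteq> pverts G" using assms by auto
  have "strongly_splitting (with_proj G \<restriction> W) S \<longleftrightarrow> stable_set (with_proj G \<restriction> W) S
    \<and> (\<forall>v\<in>S. \<forall>a b. (\<exists>C. connected_component (with_proj G \<restriction> (W - S)) C \<and> a \<in> verts C \<and> b \<in> verts C)
          \<longrightarrow> (v, a) \<in> Restr (parcs G) W \<longrightarrow> (v, b) \<in> Restr (parcs G) W \<longrightarrow> a = b)
    \<and> (\<forall>v\<in>W - S. \<exists>\<^sub>\<le>\<^sub>1u. u \<in> S \<and> (v, u) \<in> Restr (parcs G) W)"
    unfolding strongly_splitting_def induce_subgraph_verts ind adj Uniq_def by blast
  also have "\<dots> \<longleftrightarrow> splits (parcs G) W S"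
  \<comment> \<open>Both sides contain \<open>S \<subseteq> W\<close>; once it holds, restricting
    the arcs to \<open>W\<close> loses nothing.\<close>
  proof (cases "S \<subseteq> W")
    case True
    have "stable_set (with_proj G \<restriction> W) S \<longleftrightarrow> (\<forall>u\<in>S. \<forall>v\<in>S. (u, v) \<notin> parcs G)"
      unfolding stable_set_def adj induce_subgraph_verts using True by blast
    moreover have "(v, a) \<in> Restr (parcs G) W \<longleftrightarrow> (v, a) \<in> parcs G"
      if "v \<in> W" "a \<in> W" for v a using that by blast
    ultimately show ?thesis
      unfolding common[OF WS] splits_def Uniq_def using True
      by (smt (verit) DiffD1 subset_iff)
  qed (simp add: stable_set_def splits_def)
  finally show ?thesis .
qed

text \<open>An induced subgraph is determined by its vertex set, so quantifying over subgraphs is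
  quantifying over subsets of \<open>pverts G\<close>.\<close>

lemma (in pair_sym_digraph) all_induced_strongly_splitting_iff:
  "(\<forall>H. induced_subgraph H (with_proj G) \<and> verts H \<noteq> {} \<longrightarrow>
      (\<exists>S. S \<noteq> {} \<and> strongly_splitting H S)) \<longleftrightarrow> hereditarily_split (parcs G) (pverts G)"
proof -
  have "induced_subgraph H (with_proj G) \<longleftrightarrow> (\<exists>W\<subseteq>pverts G. H = with_proj G \<restriction> W)" for H
  proof
    assume H: "induced_subgraph H (with_proj G)"
    then have "verts H \<subseteq> pverts G" by (auto simp: induced_subgraph_def subgraph_def)
    moreover from this have "H = with_proj G \<restriction> verts H"
      by (intro induced_eq_verts_imp_eq[OF H]) auto
    ultimately show "\<exists>W\<subseteq>pverts G. H = with_proj G \<restriction> W" by blast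
  qed auto
  then show ?thesis
    using strongly_splitting_induce_iff
    unfolding hereditarily_split_def
    by (smt (verit, best) induce_subgraph_verts)
qed

section \<open>Embeddings, isomorphisms and induced subgraphs\<close>

definition embedding :: "('a \<Rightarrow> 'b) \<Rightarrow> 'a rel \<Rightarrow> 'a set \<Rightarrow> 'b rel \<Rightarrow> 'b set \<Rightarrow> bool" where
  "embedding f E V E' V' \<longleftrightarrow> inj_on f V \<and> f ` V \<subseteq> V'
    \<and> (\<forall>u\<in>V. \<forall>v\<in>V. (u, v) \<in> E \<longleftrightarrow> (f u, f v) \<in> E')"

lemma embedding_comp:
  assumes f: "embedding f E V E' V'" and g: "embedding g E' V' E'' V''"
  shows "embedding (g \<circ> f) E V E'' V''"
proof -
  have mem: "f u \<in> V'" if "u \<in> V" for u using f that by (auto simp: embedding_def)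
  have "inj_on (g \<circ> f) V"
    using f g by (auto simp: embedding_def intro: comp_inj_on inj_on_subset)
  then show ?thesis
    using f g mem by (simp add: embedding_def image_subset_iff)
qed

lemma embedding_of_digraph_iso:
  assumes "digraph_iso (with_proj G) H"
  obtains f where "embedding f (parcs G) (pverts G) (arcs_ends H) (verts H)"
    and "f ` pverts G = verts H"
proof -
  from assms obtain h where h: "pre_digraph.digraph_isomorphism (with_proj G) h"
    and H: "H = app_iso h (with_proj G)"
    by (auto simp: digraph_iso_def)
  interpret wf_digraph "with_proj G" using h by (auto simp: pre_digraph.digraph_isomorphism_def)
  let ?f = "iso_verts h"
  have inj: "inj_on ?f (pverts G)"
    using h by (auto simp: pre_digraph.digraph_isomorphism_def)
  have ends: "arcs_ends H = (\<lambda>(u, v). (?f u, ?f v)) ` parcs G"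
    using arcs_ends_app_iso_eq[OF h] H by simp
  have wf: "u \<in> pverts G" "v \<in> pverts G" if "(u, v) \<in> parcs G" for u v
    using tail_in_verts[of "(u, v)"] head_in_verts[of "(u, v)"] that by auto
  have "embedding ?f (parcs G) (pverts G) (arcs_ends H) (verts H)"
    unfolding embedding_def
  proof (intro conjI ballI)
    show "(u, v) \<in> parcs G \<longleftrightarrow> (?f u, ?f v) \<in> arcs_ends H"
      if "u \<in> pverts G" "v \<in> pverts G" for u v
    proof
      assume "(?f u, ?f v) \<in> arcs_ends H"
      then obtain u' v' where "(u', v') \<in> parcs G" "?f u = ?f u'" "?f v = ?f v'"
        unfolding ends by auto
      with wf[of u' v'] that inj show "(u, v) \<in> parcs G" by (metis inj_onD)
    qed (auto simp: ends)
  qed (use H inj in auto)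
  then show ?thesis using that H by simp
qed

definition relabel :: "('a \<Rightarrow> 'b) \<Rightarrow> 'a pair_pre_digraph \<Rightarrow> 'b pair_pre_digraph" where
  "relabel f G = \<lparr> pverts = f ` pverts G, parcs = map_prod f f ` parcs G \<rparr>"

lemma digraph_iso_relabel:
  assumes inj: "inj_on f (pverts G)" and G: "wf_digraph (with_proj G)"
  shows "digraph_iso (with_proj G) (with_proj (relabel f G))"
proof -
  interpret wf_digraph "with_proj G" by fact
  \<comment> \<open>Arcs are pairs, so the vertex map determines the arc map, and the endpoint
    functions remain \<open>fst\<close> and \<open>snd\<close>.\<close>
  let ?h = "\<lparr> iso_verts = f, iso_arcs = map_prod f f, iso_head = snd, iso_tail = fst \<rparr>"
  have "parcs G \<subseteq> pverts G \<times> pverts G"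
    using wellformed by (auto simp: mem_Times_iff)
  then have "inj_on (map_prod f f) (parcs G)"
    by (rule inj_on_subset[OF map_prod_inj_on[OF inj inj]])
  then have "pre_digraph.digraph_isomorphism (with_proj G) ?h"
    using G inj by (auto simp: pre_digraph.digraph_isomorphism_def)
  moreover have "with_proj (relabel f G) = app_iso ?h (with_proj G)"
    by (simp add: app_iso_def relabel_def with_proj_def)
  ultimately show ?thesis unfolding digraph_iso_def by blast
qed

text \<open>The renamed graph equals an induced subgraph of \<open>D\<close>, which turns an
  embedding into the isomorphism required by \<open>blanche_descartes\<close>.\<close>

lemma relabel_embedding:
  assumes f: "embedding f (parcs G) (pverts G) (parcs D) (pverts D)"
    and G: "wf_digraph (with_proj G)"
  shows "with_proj (relabel f G) = with_proj D \<restriction> f ` pverts G"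
proof -
  interpret wf_digraph "with_proj G" by fact
  have "map_prod f f ` parcs G = {e \<in> parcs D. fst e \<in> f ` pverts G \<and> snd e \<in> f ` pverts G}"
  proof (intro equalityI subsetI)
    fix e assume "e \<in> map_prod f f ` parcs G"
    then obtain u v where e: "e = (f u, f v)" and uv: "(u, v) \<in> parcs G" by auto
    have "u \<in> pverts G" "v \<in> pverts G" using wellformed[of "(u, v)"] uv by auto
    then show "e \<in> {e \<in> parcs D. fst e \<in> f ` pverts G \<and> snd e \<in> f ` pverts G}"
      using f e uv by (simp add: embedding_def)
  next
    fix e assume "e \<in> {e \<in> parcs D. fst e \<in> f ` pverts G \<and> snd e \<in> f ` pverts G}"
    then obtain u v where "e = (f u, f v)" "u \<in> pverts G" "v \<in> pverts G" "(f u, f v) \<in> parcs D"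
      by (cases e) auto
    then show "e \<in> map_prod f f ` parcs G"
      using f unfolding embedding_def by (intro image_eqI[of _ _ "(u, v)"]) auto
  qed
  then show ?thesis
    by (simp add: relabel_def induce_subgraph_def with_proj_def)
qed

lemma embedding_into_induced:
  assumes "induced_subgraph H (with_proj D)" "embedding f E V (arcs_ends H) (verts H)"
  shows "embedding f E V (parcs D) (pverts D)"
proof -
  have "arcs_ends H = Restr (parcs D) (verts H)" "verts H \<subseteq> pverts D"
    using assms(1)
    by (auto simp: induced_subgraph_def subgraph_def compatible_def arcs_ends_conv)
  with assms(2) show ?thesis by (auto simp: embedding_def)
qed

text \<open>The preimage of a splitting set splits, since an embedding preserves adjacency and
  carries paths avoiding the preimage to paths avoiding the set. Hence the property passes to
  induced subgraphs and isomorphic copies.\<close>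

lemma hereditarily_split_embedding:
  assumes f: "embedding f E V E' V'" and V': "hereditarily_split E' V'"
  shows "hereditarily_split E V"
  unfolding hereditarily_split_def
proof (intro allI impI)
  fix W assume W: "W \<subseteq> V" "W \<noteq> {}"
  then have "f ` W \<subseteq> V'" "f ` W \<noteq> {}" using f by (auto simp: embedding_def)
  then obtain S' where S': "S' \<noteq> {}" "splits E' (f ` W) S'"
    using V' unfolding hereditarily_split_def by blast
  define S where "S = {w \<in> W. f w \<in> S'}"
  obtain x where "x \<in> S'" using S'(1) by blast
  moreover from this have "x \<in> f ` W" using S'(2) unfolding splits_def by blast
  ultimately have "S \<noteq> {}" by (auto simp: S_def)
  have adj: "(f u, f v) \<in> E'" if "(u, v) \<in> E" "u \<in> W" "v \<in> W" for u v
    using f that W unfolding embedding_def by blast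
  have eq: "u = v" if "f u = f v" "u \<in> W" "v \<in> W" for u v
    using f that W unfolding embedding_def inj_on_def by blast
  have mem: "f a \<in> f ` W - S'" if "a \<in> W - S" for a
    using that by (auto simp: S_def)
  have reach: "(f a, f b) \<in> (Restr E' (f ` W - S'))\<^sup>*" if "(a, b) \<in> (Restr E (W - S))\<^sup>*" for a b
    using that
  proof induction
    case (step y z)
    then have "(f y, f z) \<in> Restr E' (f ` W - S')" using mem adj by auto
    with step.IH show ?case by (rule rtrancl_into_rtrancl)
  qed simp
  have "splits E W S"
    unfolding splits_def
  proof (intro conjI ballI impI)
    show "S \<subseteq> W" by (auto simp: S_def)
    show "(u, v) \<notin> E" if "u \<in> S" "v \<in> S" for u v
      using S'(2) adj[of u v] that unfolding splits_def S_def by blast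
    show "a = b" if "v \<in> S" "a \<in> W - S" "b \<in> W - S" "(v, a) \<in> E" "(v, b) \<in> E"
      "(a, b) \<in> (Restr E (W - S))\<^sup>*" for v a b
    proof (rule eq)
      have "f v \<in> S'" "v \<in> W" using that by (auto simp: S_def)
      then show "f a = f b"
        using S'(2) mem[of a] mem[of b] adj[of v a] adj[of v b] reach[of a b] that
        unfolding splits_def by blast
    qed (use that in blast)+
    show "s = t" if "v \<in> W - S" "s \<in> S" "t \<in> S" "(v, s) \<in> E" "(v, t) \<in> E" for v s t
    proof (rule eq)
      have "f s \<in> S'" "f t \<in> S'" "s \<in> W" "t \<in> W" using that by (auto simp: S_def)
      then show "f s = f t"
        using S'(2) mem[of v] adj[of v s] adj[of v t] that
        unfolding splits_def by blast
    qed (use that in \<open>auto simp: S_def\<close>)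
  qed
  with \<open>S \<noteq> {}\<close> show "\<exists>S. S \<noteq> {} \<and> splits E W S" by blast
qed

section \<open>Splitting sets in Descartes graphs\<close>

text \<open>Without \<open>S\<close> the copies are disjoint and have no arcs between them. A vertex
  of \<open>S\<close> has at most the neighbour \<open>m T s\<close> in the copy \<open>C T\<close>,
  and injectivity of \<open>m T\<close> leaves a copy vertex at most one neighbour in
  \<open>S\<close>.\<close>

lemma hereditarily_split_blowup:
  assumes split: "\<And>T. T \<in> \<T> \<Longrightarrow> hereditarily_split (parcs (C T)) (pverts (C T))"
    and wf: "\<And>T. T \<in> \<T> \<Longrightarrow> parcs (C T) \<subseteq> pverts (C T) \<times> pverts (C T)"
    and TS: "\<And>T. T \<in> \<T> \<Longrightarrow> T \<subseteq> S"
    and CS: "\<And>T. T \<in> \<T> \<Longrightarrow> pverts (C T) \<inter> S = {}"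
    and disj: "disjoint_family_on (\<lambda>T. pverts (C T)) \<T>"
    and m: "\<And>T. T \<in> \<T> \<Longrightarrow> bij_betw (m T) T (pverts (C T))"
    and E: "E = (\<Union>T\<in>\<T>. parcs (C T) \<union> (\<Union>t\<in>T. {(t, m T t), (m T t, t)}))"
    and V: "V = S \<union> (\<Union>T\<in>\<T>. pverts (C T))"
  shows "hereditarily_split E V"
  unfolding hereditarily_split_def
proof (intro allI impI)
  fix W assume W: "W \<subseteq> V" "W \<noteq> {}"
  have E_cases: "\<exists>T\<in>\<T>. (u, v) \<in> parcs (C T) \<or> u \<in> T \<and> v = m T u \<or> v \<in> T \<and> u = m T v"
    if "(u, v) \<in> E" for u v
    using that unfolding E by blast
  have W_cases: "\<exists>T\<in>\<T>. u \<in> pverts (C T)" if "u \<in> W" "u \<notin> S" for u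
    using W(1) that unfolding V by blast
  have mC: "m T t \<in> pverts (C T)" if "T \<in> \<T>" "t \<in> T" for T t
    using m[OF that(1)] that(2) by (auto simp: bij_betw_def)
  have uniq: "T = T'" if "u \<in> pverts (C T)" "u \<in> pverts (C T')" "T \<in> \<T>" "T' \<in> \<T>" for u T T'
    using disj that unfolding disjoint_family_on_def by blast
  have inside: "(u, v) \<in> parcs (C T)"
    if "(u, v) \<in> E" "u \<in> pverts (C T)" "T \<in> \<T>" "v \<notin> S" for u v T
  proof -
    have "u \<notin> S" using that CS by blast
    with E_cases[OF that(1)] that(4) obtain T' where "T' \<in> \<T>" "(u, v) \<in> parcs (C T')"
      using TS by blast
    moreover from this have "T' = T" using wf that uniq by blast
    ultimately show ?thesis by simp
  qed
  \<comment> \<open>An arc between \<open>S\<close> and a copy vertex is a matching arc of some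
    \<open>T'\<close>; its copy end lies in \<open>C T'\<close>, so disjointness of the copies
    forces \<open>T' = T\<close>.\<close>
  have cross: "s \<in> T \<and> u = m T s"
    if adj: "(u, s) \<in> E \<or> (s, u) \<in> E" and "u \<in> pverts (C T)" "T \<in> \<T>" "s \<in> S" for u s T
  proof -
    have "u \<notin> S" using that CS by blast
    moreover obtain T' where T': "T' \<in> \<T>" "(u, s) \<in> parcs (C T') \<or> (s, u) \<in> parcs (C T')
        \<or> u \<in> T' \<and> s = m T' u \<or> s \<in> T' \<and> u = m T' s"
      using adj E_cases[of u s] E_cases[of s u] by blast
    moreover have "s \<notin> pverts (C T')" using that(4) CS[OF T'(1)] by blast
    ultimately have "s \<in> T'" "u = m T' s" using wf[of T'] TS[of T'] by blast+
    moreover from this have "T' = T" using uniq[of u T' T] mC T' that by blast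
    ultimately show ?thesis by simp
  qed
  have stable: "(s, t) \<notin> E" if "s \<in> S" "t \<in> S" for s t
  proof
    assume "(s, t) \<in> E"
    then obtain T where T: "T \<in> \<T>" "(s, t) \<in> parcs (C T) \<or> s \<in> T \<and> t = m T s \<or> t \<in> T \<and> s = m T t"
      using E_cases by blast
    then have "s \<in> pverts (C T) \<or> t \<in> pverts (C T)" using wf[of T] mC[of T] by blast
    with CS[OF T(1)] that show False by blast
  qed
  show "\<exists>S. S \<noteq> {} \<and> splits E W S"
  proof (cases "W \<inter> S = {}")
    case False
    \<comment> \<open>A path in \<open>W - S\<close> never leaves its copy, so two neighbours of
      \<open>v\<close> on such a path are both \<open>m T v\<close>.\<close>
    have stay: "b \<in> pverts (C T)"
      if "(a, b) \<in> (Restr E (W - W \<inter> S))\<^sup>*" "a \<in> pverts (C T)" "T \<in> \<T>" for a b T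
      using that(1)
    proof induction
      case (step y z)
      then have "(y, z) \<in> parcs (C T)" using inside that by blast
      then show ?case using wf that by blast
    qed (use that in simp)
    have "splits E W (W \<inter> S)"
      unfolding splits_def
    proof (intro conjI ballI impI)
      fix v a b
      assume "v \<in> W \<inter> S" "a \<in> W - W \<inter> S" "b \<in> W - W \<inter> S" "(v, a) \<in> E" "(v, b) \<in> E"
        and ab: "(a, b) \<in> (Restr E (W - W \<inter> S))\<^sup>*"
      moreover from this obtain T where T: "T \<in> \<T>" "a \<in> pverts (C T)"
        using W_cases[of a] by blast
      moreover have "b \<in> pverts (C T)" using stay[OF ab] T by blast
      ultimately show "a = b" using cross[of a v T] cross[of b v T] by blast
    next
      fix v s t
      assume v: "v \<in> W - W \<inter> S" "s \<in> W \<inter> S" "t \<in> W \<inter> S" "(v, s) \<in> E" "(v, t) \<in> E"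
      then obtain T where T: "T \<in> \<T>" "v \<in> pverts (C T)" using W_cases[of v] by blast
      then have "s \<in> T" "t \<in> T" "m T s = m T t" using v cross[of v s T] cross[of v t T] by auto
      with m[OF T(1)] show "s = t" by (auto simp: bij_betw_def inj_on_def)
    qed (use stable in blast)+
    with False show ?thesis by (intro exI[of _ "W \<inter> S"] conjI)
  next
    case True
    then obtain u T where T: "T \<in> \<T>" "u \<in> W" "u \<in> pverts (C T)" using W(2) W_cases by blast
    let ?W = "W \<inter> pverts (C T)"
    have "?W \<subseteq> pverts (C T)" "?W \<noteq> {}" using T by auto
    then obtain R where R: "R \<noteq> {}" "splits (parcs (C T)) ?W R"
      using split[OF T(1)] unfolding hereditarily_split_def by blast
    have R_sub: "R \<subseteq> ?W" using R(2) unfolding splits_def by blast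
    \<comment> \<open>Within \<open>W\<close>, no arc leaves or enters the trace \<open>?W\<close>
      of the chosen copy. Both directions are proved, as the arcs are not assumed symmetric
      here.\<close>
    have inW: "(u, v) \<in> parcs (C T) \<and> v \<in> ?W"
      if "(u, v) \<in> E" "u \<in> ?W" "v \<in> W" for u v
      using inside[OF that(1) _ T(1)] that True wf[OF T(1)] by blast
    have inW': "v \<in> ?W" if "(v, u) \<in> E" "u \<in> ?W" and v: "v \<in> W" for u v
    proof -
      obtain T' where T': "T' \<in> \<T>" "v \<in> pverts (C T')" using v True W_cases[of v] by blast
      then have "(v, u) \<in> parcs (C T')" using inside[OF that(1)] that True by blast
      then have "T' = T" using uniq[of u T' T] wf[OF T'(1)] that T T' by blast
      then show ?thesis using T' that by blast
    qed
    have reach: "(a, b) \<in> (Restr (parcs (C T)) (?W - R))\<^sup>* \<and> b \<in> ?W"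
      if "(a, b) \<in> (Restr E (W - R))\<^sup>*" "a \<in> ?W" for a b
      using that(1)
    proof induction
      case (step y z)
      then have "(y, z) \<in> Restr (parcs (C T)) (?W - R)" using inW[of y z] by blast
      then show ?case using step.IH by (auto intro: rtrancl_into_rtrancl)
    qed (use that in simp)
    have "splits E W R"
      unfolding splits_def
    proof (intro conjI ballI impI)
      show "R \<subseteq> W" using R_sub by blast
      show "(u, v) \<notin> E" if "u \<in> R" "v \<in> R" for u v
        using inW[of u v] that R_sub R(2) unfolding splits_def by blast
      show "a = b" if "v \<in> R" "a \<in> W - R" "b \<in> W - R" "(v, a) \<in> E" "(v, b) \<in> E"
        "(a, b) \<in> (Restr E (W - R))\<^sup>*" for v a b
      proof -
        have "v \<in> ?W" using that R_sub by blast
        then have "(v, a) \<in> parcs (C T)" "(v, b) \<in> parcs (C T)" "a \<in> ?W - R" "b \<in> ?W - R"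
          using inW[of v a] inW[of v b] that by blast+
        with reach[OF that(6)] that(1) R(2) show ?thesis unfolding splits_def by blast
      qed
      show "s = t" if "v \<in> W - R" "s \<in> R" "t \<in> R" "(v, s) \<in> E" "(v, t) \<in> E" for v s t
      proof -
        have "v \<in> ?W - R" using inW'[OF that(4)] that R_sub by blast
        then have "(v, s) \<in> parcs (C T)" "(v, t) \<in> parcs (C T)"
          using inW[of v s] inW[of v t] that R_sub by blast+
        with \<open>v \<in> ?W - R\<close> that(2,3) R(2) show ?thesis unfolding splits_def by blast
      qed
    qed
    with R(1) show ?thesis by (intro exI[of _ R] conjI)
  qed
qed

lemma descartes_wf:
  "descartes k D \<Longrightarrow> finite (pverts D) \<and> pverts D \<noteq> {} \<and> wf_digraph (with_proj D)"
proof (induction rule: descartes.induct)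
  case (step k D n S \<T> C m)
  have TS: "T \<subseteq> S" if "T \<in> \<T>" for T using that step by blast
  have iso: "digraph_iso (with_proj D) (with_proj (C T))" if "T \<in> \<T>" for T
    using that step by blast
  have C: "finite (pverts (C T))" if T: "T \<in> \<T>" for T
  proof -
    obtain f where "f ` pverts D = verts (with_proj (C T))"
      using embedding_of_digraph_iso[OF iso[OF T]] by blast
    then show ?thesis using step.IH by (metis finite_imageI with_proj_simps(1))
  qed
  have wf: "u \<in> pverts (C T) \<and> v \<in> pverts (C T)" if "(u, v) \<in> parcs (C T)" "T \<in> \<T>" for u v T
  proof -
    interpret wf_digraph "with_proj D" using step.IH by blast
    have "wf_digraph (with_proj (C T))"
      using iso[OF that(2)] unfolding digraph_iso_def by (auto intro: wf_digraphI_app_iso)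
    then show ?thesis using that(1) wf_digraph.wellformed[of "with_proj (C T)" "(u, v)"] by simp
  qed
  have m: "m T t \<in> pverts (C T)" if "T \<in> \<T>" "t \<in> T" for T t
    using step.hyps(9) that by (auto dest: bij_betwE)
  have "finite \<T>" using step by simp
  then have "finite (S \<union> (\<Union>T\<in>\<T>. pverts (C T)))" using C step by blast
  \<comment> \<open>The summand 1 in the size of \<open>S\<close> makes it non-empty.\<close>
  moreover have "S \<noteq> {}" using step by auto
  moreover have "u \<in> S \<union> (\<Union>T\<in>\<T>. pverts (C T)) \<and> v \<in> S \<union> (\<Union>T\<in>\<T>. pverts (C T))"
    if "(u, v) \<in> (\<Union>T\<in>\<T>. parcs (C T) \<union> (\<Union>t\<in>T. {(t, m T t), (m T t, t)}))" for u v
  proof -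
    from that obtain T where "T \<in> \<T>"
      "(u, v) \<in> parcs (C T) \<or> u \<in> T \<and> v = m T u \<or> v \<in> T \<and> u = m T v" by blast
    then show ?thesis using wf[of u v T] m[of T] TS[of T] by blast
  qed
  ultimately show ?case
    by (simp add: wf_digraph_def split_paired_all del: UN_iff Un_iff)
qed (auto simp: wf_digraph_def)

lemma descartes_hereditarily_split:
  "descartes k D \<Longrightarrow> hereditarily_split (parcs D) (pverts D)"
proof (induction rule: descartes.induct)
  case (one v)
  have "splits {} {v} {v}" by (auto simp: splits_def)
  then show ?case by (auto simp: hereditarily_split_def subset_singleton_iff)
next
  case (step k D n S \<T> C m)
  have wfD: "wf_digraph (with_proj D)" using descartes_wf step by blast
  have iso: "digraph_iso (with_proj D) (with_proj (C T))" if "T \<in> \<T>" for T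
    using that step by blast
  show ?case
    unfolding pair_pre_digraph.simps
  proof (rule hereditarily_split_blowup)
    fix T assume T: "T \<in> \<T>"
    interpret wf_digraph "with_proj D" by fact
    \<comment> \<open>The isomorphism is reversed because hereditary splitting is transferred from
      the target of an embedding to its source.\<close>
    have "digraph_iso (with_proj (C T)) (with_proj D)"
      using digraph_iso_swap[OF wfD iso[OF T]] .
    then obtain f where "embedding f (parcs (C T)) (pverts (C T)) (parcs D) (pverts D)"
      using embedding_of_digraph_iso by (metis with_proj_simps(1,3))
    then show "hereditarily_split (parcs (C T)) (pverts (C T))"
      using hereditarily_split_embedding step.IH by blast
    have "wf_digraph (with_proj (C T))"
      using iso[OF T] unfolding digraph_iso_def by (auto intro: wf_digraphI_app_iso)
    then show "parcs (C T) \<subseteq> pverts (C T) \<times> pverts (C T)"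
      using wf_digraph.wellformed[of "with_proj (C T)"] by fastforce
  qed (use step in auto)
qed

section \<open>Embedding into Descartes graphs\<close>

text \<open>
  One outcome of the construction step over the stable set \<open>{..<M}\<close>: the injective encoding of
  \<open>(T, x)\<close>, shifted by \<open>M\<close>, keeps the copies disjoint from each other and from the stable set.
\<close>

definition copy_vertex :: "nat \<Rightarrow> nat set \<Rightarrow> nat \<Rightarrow> nat" where
  "copy_vertex M T x = M + prod_encode (set_encode T, x)"

definition subsets_of_card :: "nat \<Rightarrow> nat \<Rightarrow> nat set set" where
  "subsets_of_card M n = {T. T \<subseteq> {..<M} \<and> card T = n}"

text \<open>Here \<open>m T\<close> maps onto the vertices of \<open>D\<close> itself, and
  \<open>copy_vertex M T\<close> carries its values into the copy; matchings can thus be prescribed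
  in terms of \<open>D\<close>.\<close>

definition blowup :: "nat pair_pre_digraph \<Rightarrow> nat \<Rightarrow> (nat set \<Rightarrow> nat \<Rightarrow> nat) \<Rightarrow> nat pair_pre_digraph" where
  "blowup D M m =
    (let \<T> = subsets_of_card M (card (pverts D)); C = \<lambda>T. relabel (copy_vertex M T) D
     in \<lparr> pverts = {..<M} \<union> (\<Union>T\<in>\<T>. pverts (C T)),
          parcs = (\<Union>T\<in>\<T>. parcs (C T)
            \<union> (\<Union>t\<in>T. {(t, (copy_vertex M T \<circ> m T) t), ((copy_vertex M T \<circ> m T) t, t)})) \<rparr>)"

lemma subsets_of_cardD: "T \<in> subsets_of_card M n \<Longrightarrow> finite T \<and> T \<subseteq> {..<M} \<and> card T = n"
  by (auto simp: subsets_of_card_def intro: finite_subset)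

text \<open>\<open>set_encode\<close> is injective on finite sets only; membership in
  \<open>subsets_of_card\<close> supplies finiteness.\<close>

lemma copy_vertex_eq_iff:
  "T \<in> subsets_of_card M n \<Longrightarrow> T' \<in> subsets_of_card M n'
    \<Longrightarrow> copy_vertex M T x = copy_vertex M T' y \<longleftrightarrow> T = T' \<and> x = y"
  by (simp add: copy_vertex_def set_encode_eq subsets_of_cardD)

lemma copy_vertex_not_less [simp]: "\<not> copy_vertex M T x < M"
  by (simp add: copy_vertex_def)

lemma descartes_blowup:
  assumes D: "descartes k D" and M: "M = k * (card (pverts D) - 1) + 1"
    and m: "\<And>T. T \<in> subsets_of_card M (card (pverts D)) \<Longrightarrow> bij_betw (m T) T (pverts D)"
  shows "descartes (Suc k) (blowup D M m)"
  unfolding blowup_def Let_def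
proof (rule descartes.step[OF D refl])
  let ?\<T> = "subsets_of_card M (card (pverts D))"
  have inj: "inj_on (copy_vertex M T) A" if "T \<in> ?\<T>" for T A
    using copy_vertex_eq_iff[OF that that] by (simp add: inj_on_def)
  show "\<forall>T\<in>?\<T>. digraph_iso (with_proj D) (with_proj (relabel (copy_vertex M T) D))"
    using descartes_wf[OF D] inj digraph_iso_relabel by blast
  show "\<forall>T\<in>?\<T>. pverts (relabel (copy_vertex M T) D) \<inter> {..<M} = {}"
    by (auto simp: relabel_def)
  show "disjoint_family_on (\<lambda>T. pverts (relabel (copy_vertex M T) D)) ?\<T>"
    by (auto simp: disjoint_family_on_def relabel_def copy_vertex_eq_iff)
  show "\<forall>T\<in>?\<T>. bij_betw (copy_vertex M T \<circ> m T) T (pverts (relabel (copy_vertex M T) D))"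
  proof
    fix T assume T: "T \<in> ?\<T>"
    show "bij_betw (copy_vertex M T \<circ> m T) T (pverts (relabel (copy_vertex M T) D))"
      by (rule bij_betw_trans[OF m[OF T]]) (simp add: relabel_def inj_on_imp_bij_betw inj[OF T])
  qed
qed (simp_all add: M subsets_of_card_def)

text \<open>This rule and the next two cover all vertex pairs of a blowup, since each vertex is
  below \<open>M\<close> or a copy vertex.\<close>

lemma blowup_arc_base: "i < M \<Longrightarrow> j < M \<Longrightarrow> (i, j) \<notin> parcs (blowup D M m)"
  by (auto simp: blowup_def relabel_def Let_def copy_vertex_def)

lemma blowup_arc_matching:
  assumes "i < M" "T \<in> subsets_of_card M (card (pverts D))"
  shows "(i, copy_vertex M T x) \<in> parcs (blowup D M m) \<longleftrightarrow> i \<in> T \<and> m T i = x"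
    and "(copy_vertex M T x, i) \<in> parcs (blowup D M m) \<longleftrightarrow> i \<in> T \<and> m T i = x"
proof -
  have less: "t < M" if "T' \<in> subsets_of_card M (card (pverts D))" "t \<in> T'" for t T'
    using that subsets_of_cardD by blast
  show "(i, copy_vertex M T x) \<in> parcs (blowup D M m) \<longleftrightarrow> i \<in> T \<and> m T i = x"
    using assms by (auto simp: blowup_def relabel_def Let_def copy_vertex_eq_iff dest: less)
  show "(copy_vertex M T x, i) \<in> parcs (blowup D M m) \<longleftrightarrow> i \<in> T \<and> m T i = x"
    using assms by (auto simp: blowup_def relabel_def Let_def copy_vertex_eq_iff dest: less)
qed

lemma blowup_arc_copy:
  assumes "T \<in> subsets_of_card M (card (pverts D))" "T' \<in> subsets_of_card M (card (pverts D))"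
  shows "(copy_vertex M T x, copy_vertex M T' y) \<in> parcs (blowup D M m) \<longleftrightarrow> T = T' \<and> (x, y) \<in> parcs D"
proof -
  have less: "t < M" if "T' \<in> subsets_of_card M (card (pverts D))" "t \<in> T'" for t T'
    using that subsets_of_cardD by blast
  show ?thesis
    using assms by (force simp: blowup_def relabel_def Let_def copy_vertex_eq_iff dest: less)
qed

text \<open>Removing the matched part leaves sets of equal size on both sides. This completes a
  partial matching to a perfect one.\<close>

lemma bij_betw_extend:
  assumes T: "finite T" "finite B" "card T = card B" and A: "A \<subseteq> T"
    and g: "inj_on g A" "g ` A \<subseteq> B"
  obtains b where "bij_betw b T B" "\<And>t. t \<in> A \<Longrightarrow> b t = g t"
proof -
  have "card (T - A) = card (B - g ` A)"
    using assms by (simp add: card_Diff_subset finite_subset card_image)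
  then obtain h where h: "bij_betw h (T - A) (B - g ` A)"
    using finite_same_card_bij[of "T - A" "B - g ` A"] T by auto
  let ?b = "\<lambda>t. if t \<in> A then g t else h t"
  have "bij_betw ?b A (g ` A)"
    using g(1) by (simp add: bij_betw_def inj_on_def)
  moreover have "bij_betw ?b (T - A) (B - g ` A)"
    using h by (rule bij_betw_cong[THEN iffD1, rotated]) simp
  ultimately have "bij_betw ?b (A \<union> (T - A)) (g ` A \<union> (B - g ` A))"
    by (rule bij_betw_combine) auto
  moreover have "A \<union> (T - A) = T" "g ` A \<union> (B - g ` A) = B" using A g(2) by auto
  ultimately show ?thesis using that by simp
qed

section \<open>Raising the level of the construction\<close>

lemma descartes_pos: "descartes k D \<Longrightarrow> k > 0"
  by (cases rule: descartes.cases) auto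

text \<open>\<open>D\<close> sits inside the next graph as a single copy, and the base vertex 0 lies
  outside that copy, so the size grows strictly.\<close>

lemma descartes_larger:
  assumes D: "descartes k D"
  obtains D' f where "descartes (Suc k) D'" "embedding f (parcs D) (pverts D) (parcs D') (pverts D')"
    "card (pverts D) < card (pverts D')"
proof -
  define n where "n = card (pverts D)"
  define M where "M = k * (n - 1) + 1"
  have fin: "finite (pverts D)" and n: "n > 0"
    using descartes_wf[OF D] by (auto simp: n_def card_gt_0_iff)
  \<comment> \<open>As \<open>k\<close> is positive, \<open>n \<le> M\<close>, so the base has an
    \<open>n\<close>-element subset to carry a copy.\<close>
  have "n - 1 \<le> k * (n - 1)" using descartes_pos[OF D] by simp
  then have "n \<le> M" using n unfolding M_def by linarith
  then have T: "{..<n} \<in> subsets_of_card M n" by (auto simp: subsets_of_card_def)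
  have "\<exists>b. bij_betw b T (pverts D)" if "T \<in> subsets_of_card M n" for T
    using finite_same_card_bij[of T] fin subsets_of_cardD[OF that] by (auto simp: n_def)
  then obtain m where m: "\<And>T. T \<in> subsets_of_card M n \<Longrightarrow> bij_betw (m T) T (pverts D)"
    by metis
  have D': "descartes (Suc k) (blowup D M m)"
    using descartes_blowup[OF D] m unfolding n_def M_def by blast
  let ?f = "copy_vertex M {..<n}"
  have inj: "inj_on ?f (pverts D)" using copy_vertex_eq_iff[OF T T] by (simp add: inj_on_def)
  have sub: "?f ` pverts D \<subseteq> pverts (blowup D M m)"
    using T unfolding blowup_def relabel_def Let_def n_def by auto
  have emb: "embedding ?f (parcs D) (pverts D) (parcs (blowup D M m)) (pverts (blowup D M m))"
    using inj sub blowup_arc_copy[of "{..<n}" M D "{..<n}"] T by (simp add: embedding_def n_def)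
  have "0 \<in> pverts (blowup D M m)" by (simp add: blowup_def Let_def M_def)
  moreover have "0 \<notin> ?f ` pverts D" by (auto simp: copy_vertex_def M_def)
  ultimately have "?f ` pverts D \<subset> pverts (blowup D M m)" using sub by blast
  then have "card (?f ` pverts D) < card (pverts (blowup D M m))"
    using descartes_wf[OF D'] psubset_card_mono by blast
  then show ?thesis using that[OF D' emb] by (simp add: card_image[OF inj])
qed

lemma descartes_arbitrarily_large:
  assumes "descartes k D"
  shows "\<exists>D' f. descartes (k + j) D' \<and> embedding f (parcs D) (pverts D) (parcs D') (pverts D')
    \<and> j + card (pverts D) \<le> card (pverts D')"
proof (induction j)
  case 0
  have "embedding id (parcs D) (pverts D) (parcs D) (pverts D)" by (simp add: embedding_def)
  then show ?case using assms by auto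
next
  case (Suc j)
  then obtain D' f where *: "descartes (k + j) D'" "j + card (pverts D) \<le> card (pverts D')"
    "embedding f (parcs D) (pverts D) (parcs D') (pverts D')" by blast
  obtain D'' g where "descartes (Suc (k + j)) D''" "card (pverts D') < card (pverts D'')"
    "embedding g (parcs D') (pverts D') (parcs D'') (pverts D'')"
    using descartes_larger[OF *(1)] by blast
  moreover from this have "embedding (g \<circ> f) (parcs D) (pverts D) (parcs D'') (pverts D'')"
    using embedding_comp[OF *(3)] by blast
  moreover have "Suc j + card (pverts D) \<le> card (pverts D'')"
    using *(2) calculation(2) by linarith
  ultimately show ?case
    unfolding add_Suc_right by blast
qed

section \<open>From a splitting set to an embedding one level up\<close>

text \<open>The size conditions leave room in the base: positions below \<open>card V\<close>
  receive \<open>S\<close>, and after them come \<open>card V\<close> blocks of length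
  \<open>n\<close>, one for each possible component of \<open>V - S\<close>.\<close>

lemma splits_embedding:
  fixes V :: "'a set" and D :: "nat pair_pre_digraph"
  assumes D: "descartes k D" and V: "finite V" and sym: "sym E" and S: "splits E V S"
    and e: "embedding e E (V - S) (parcs D) (pverts D)"
    and n_def: "n = card (pverts D)" and n: "card V < n"
    and M_def: "M = k * (n - 1) + 1" and M: "card V + n * card V \<le> M"
  obtains D' f where "descartes (Suc k) D'" "embedding f E V (parcs D') (pverts D')"
proof -
  define v where "v = card V"
  have SV: "S \<subseteq> V" using S by (simp add: splits_def)
  have fin: "finite (pverts D)" using descartes_wf[OF D] by simp
  have e_inj: "x = y" if "e x = e y" "x \<in> V - S" "y \<in> V - S" for x y
    using e that by (auto simp: embedding_def inj_on_def)
  have e_mem: "e x \<in> pverts D" if "x \<in> V - S" for x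
    using e that by (auto simp: embedding_def)
  \<comment> \<open>Since \<open>E\<close> is symmetric, this is an equivalence relation on
    \<open>V - S\<close> whose classes are the components.\<close>
  define R where "R = (Restr E (V - S))\<^sup>*"
  have "sym R" unfolding R_def using sym by (intro sym_rtrancl) (auto simp: sym_def)
  have "trans R" unfolding R_def by (rule trans_rtrancl)
  obtain h where h: "bij_betw h ((\<lambda>u. R `` {u}) ` (V - S)) {0..<card ((\<lambda>u. R `` {u}) ` (V - S))}"
    using ex_bij_betw_finite_nat[of "(\<lambda>u. R `` {u}) ` (V - S)"] V by auto
  \<comment> \<open>numbering of the components of \<open>V - S\<close>\<close>
  define c where "c u = h (R `` {u})" for u
  have c_less: "c u < v" if "u \<in> V - S" for u
  proof -
    have "c u \<in> {0..<card ((\<lambda>u. R `` {u}) ` (V - S))}"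
      using bij_betwE[OF h] that by (auto simp: c_def)
    moreover have "card ((\<lambda>u. R `` {u}) ` (V - S)) \<le> card (V - S)"
      using V by (intro card_image_le) auto
    moreover have "card (V - S) \<le> v" using V by (auto simp: v_def intro: card_mono)
    ultimately show ?thesis by simp
  qed
  have c_eq: "c x = c y \<longleftrightarrow> (x, y) \<in> R" if "x \<in> V - S" "y \<in> V - S" for x y
  proof -
    have "c x = c y \<longleftrightarrow> R `` {x} = R `` {y}"
      using bij_betw_imp_inj_on[OF h] that by (auto simp: c_def inj_on_def)
    also have "\<dots> \<longleftrightarrow> (x, y) \<in> R"
    proof
      assume "R `` {x} = R `` {y}"
      moreover have "(y, y) \<in> R" by (simp add: R_def)
      ultimately show "(x, y) \<in> R" by blast
    next
      assume "(x, y) \<in> R"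
      with \<open>sym R\<close> \<open>trans R\<close> show "R `` {x} = R `` {y}"
        unfolding sym_def trans_def by blast
    qed
    finally show ?thesis .
  qed
  have c_adj: "c x = c y" if "x \<in> V - S" "y \<in> V - S" "(x, y) \<in> E" for x y
    using c_eq that by (auto simp: R_def)
  have S_stable: "(s, t) \<notin> E" if "s \<in> S" "t \<in> S" for s t
    using S that unfolding splits_def by blast
  \<comment> \<open>This fact and the next are the two uniqueness conditions of
    \<open>splits\<close>: together they make the arcs between \<open>S\<close> and one component a
    partial matching.\<close>
  have nbr_uniq: "x = y"
    if "s \<in> S" "x \<in> V - S" "y \<in> V - S" "(s, x) \<in> E" "(s, y) \<in> E" "c x = c y" for s x y
  proof -
    have "(x, y) \<in> (Restr E (V - S))\<^sup>*" using that c_eq[of x y] by (simp add: R_def)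
    with that S show ?thesis unfolding splits_def by blast
  qed
  have S_nbr_uniq: "s = t"
    if "x \<in> V - S" "s \<in> S" "t \<in> S" "(s, x) \<in> E" "(t, x) \<in> E" for s t x
    using S that symD[OF sym that(4)] symD[OF sym that(5)] unfolding splits_def by blast
  have "card S \<le> v" using SV V by (auto simp: v_def intro: card_mono)
  have "finite S" using SV V by (rule finite_subset)
  obtain \<sigma> where \<sigma>: "bij_betw \<sigma> S {0..<card S}"
    using ex_bij_betw_finite_nat[OF \<open>finite S\<close>] by blast
  have \<sigma>_less: "\<sigma> s < v" if "s \<in> S" for s
    using bij_betwE[OF \<sigma>] that \<open>card S \<le> v\<close> by fastforce
  have \<sigma>_eq: "\<sigma> s = \<sigma> t \<longleftrightarrow> s = t" if "s \<in> S" "t \<in> S" for s t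
    using bij_betw_imp_inj_on[OF \<sigma>] that by (auto simp: inj_on_def)
  define N where "N i = {s \<in> S. \<exists>u\<in>V - S. c u = i \<and> (s, u) \<in> E}" for i
  have N_sub: "N i \<subseteq> S" for i by (auto simp: N_def)
  have N_card: "card (N i) \<le> v" for i
    using card_mono[OF \<open>finite S\<close> N_sub] \<open>card S \<le> v\<close> by (rule le_trans)
  \<comment> \<open>The filler block is non-empty as \<open>card (N i) < n\<close>; this makes the \<open>T i\<close> distinct.\<close>
  define T where "T i = \<sigma> ` N i \<union> {v + n * i..<v + n * i + (n - card (N i))}" for i
  have T_mem_less: "t \<in> T i \<longleftrightarrow> t \<in> \<sigma> ` N i" if "t < v" for t i
    using that by (auto simp: T_def)
  \<comment> \<open>The first filler position of block \<open>i\<close> is a marker that belongs to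
    \<open>T i\<close> and to no other \<open>T j\<close>.\<close>
  have T_mem_ge: "v + n * i \<in> T j \<longleftrightarrow> i = j" for i j
  proof -
    have "v + n * i \<notin> \<sigma> ` N j" using \<sigma>_less N_sub[of j] by fastforce
    then have "v + n * i \<in> T j \<longleftrightarrow> n * j \<le> n * i \<and> n * i < n * j + (n - card (N j))"
      by (auto simp: T_def)
    also have "\<dots> \<longleftrightarrow> i = j"
    proof
      assume *: "n * j \<le> n * i \<and> n * i < n * j + (n - card (N j))"
      then have "j \<le> i" using n by simp
      moreover have "n * i < n * Suc j" using * unfolding mult_Suc_right by linarith
      then have "i < Suc j" by (metis mult_less_cancel1)
      ultimately show "i = j" by simp
    next
      assume "i = j"
      then show "n * j \<le> n * i \<and> n * i < n * j + (n - card (N j))"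
        using N_card[of j] n by (simp add: v_def)
    qed
    finally show ?thesis .
  qed
  then have T_inj: "T i = T j \<longleftrightarrow> i = j" for i j by metis
  have T_in: "T i \<in> subsets_of_card M n" if "i < v" for i
  proof -
    have disj: "\<sigma> ` N i \<inter> {v + n * i..<v + n * i + (n - card (N i))} = {}"
      using \<sigma>_less N_sub[of i] by fastforce
    have "inj_on \<sigma> (N i)" using bij_betw_imp_inj_on[OF \<sigma>] N_sub inj_on_subset by blast
    then have "card (\<sigma> ` N i) = card (N i)" by (rule card_image)
    moreover have "finite (\<sigma> ` N i)" using \<open>finite S\<close> N_sub finite_subset by blast
    ultimately have "card (T i) = n"
      using N_card[of i] n disj by (simp add: T_def card_Un_disjoint v_def)
    moreover have "T i \<subseteq> {..<M}"
    proof
      fix t assume t: "t \<in> T i"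
      \<comment> \<open>Block \<open>i\<close> ends by \<open>v + n * Suc i\<close>, which is at
        most \<open>v + n * v\<close> and so fits into the base.\<close>
      have "n * Suc i \<le> n * v" using that by (intro mult_le_mono2) simp
      then have "v + n * i + n \<le> M" using M by (simp add: v_def)
      moreover have "t < v \<or> t < v + n * i + n"
        using t \<sigma>_less N_sub[of i] by (auto simp: T_def)
      ultimately show "t \<in> {..<M}" by auto
    qed
    ultimately show ?thesis by (simp add: subsets_of_card_def)
  qed
  define nbr where "nbr i t = (SOME u. u \<in> V - S \<and> c u = i \<and> (the_inv_into S \<sigma> t, u) \<in> E)" for i t
  have nbr: "nbr i (\<sigma> s) = u" if "u \<in> V - S" "c u = i" "s \<in> S" "(s, u) \<in> E" for i s u
  proof -
    have s: "the_inv_into S \<sigma> (\<sigma> s) = s"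
      using the_inv_into_f_f bij_betw_imp_inj_on[OF \<sigma>] that by metis
    show ?thesis
      unfolding nbr_def s using that nbr_uniq by (intro some_equality) blast+
  qed
  have N_nbr: "\<exists>u\<in>V - S. c u = i \<and> (s, u) \<in> E \<and> nbr i (\<sigma> s) = u" if "s \<in> N i" for i s
    using that nbr unfolding N_def by blast
  have match: "\<exists>b. bij_betw b (T i) (pverts D) \<and> (\<forall>s\<in>N i. b (\<sigma> s) = e (nbr i (\<sigma> s)))"
    if "i < v" for i
  proof -
    have "inj_on (\<lambda>t. e (nbr i t)) (\<sigma> ` N i)"
    proof (rule inj_onI, elim imageE)
      fix x y s t
      assume *: "e (nbr i x) = e (nbr i y)" "x = \<sigma> s" "s \<in> N i" "y = \<sigma> t" "t \<in> N i"
      obtain u w where "u \<in> V - S" "(s, u) \<in> E" "nbr i x = u"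
        "w \<in> V - S" "(t, w) \<in> E" "nbr i y = w"
        using N_nbr[of s i] N_nbr[of t i] * by blast
      moreover from this have "u = w" using e_inj * by blast
      ultimately have "s = t" using S_nbr_uniq[of u s t] N_sub * by blast
      then show "x = y" using * by simp
    qed
    moreover have "(\<lambda>t. e (nbr i t)) ` \<sigma> ` N i \<subseteq> pverts D"
      using N_nbr e_mem by fastforce
    moreover have "finite (T i)" "card (T i) = card (pverts D)"
      using subsets_of_cardD[OF T_in[OF that]] by (auto simp: n_def)
    moreover have "\<sigma> ` N i \<subseteq> T i" by (auto simp: T_def)
    ultimately obtain b where "bij_betw b (T i) (pverts D)"
      "\<And>t. t \<in> \<sigma> ` N i \<Longrightarrow> b t = e (nbr i t)"
      using bij_betw_extend[of "T i" "pverts D" "\<sigma> ` N i" "\<lambda>t. e (nbr i t)"] fin by blast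
    then show ?thesis by blast
  qed
  \<comment> \<open>By \<open>T_inj\<close> a set \<open>X\<close> equals \<open>T i\<close> for at
    most one \<open>i\<close>, so the demands on its matching cannot conflict; any other
    \<open>X\<close> gets an arbitrary bijection.\<close>
  have "\<exists>b. bij_betw b X (pverts D) \<and> (\<forall>i<v. X = T i \<longrightarrow> (\<forall>s\<in>N i. b (\<sigma> s) = e (nbr i (\<sigma> s))))"
    if X: "X \<in> subsets_of_card M n" for X
  proof (cases "\<exists>i<v. X = T i")
    case True
    then obtain i where "i < v" "X = T i" by blast
    then show ?thesis using match[of i] T_inj by metis
  next
    case False
    then show ?thesis
      using finite_same_card_bij[of X "pverts D"] subsets_of_cardD[OF X] fin by (auto simp: n_def)
  qed
  then obtain m where m: "\<And>X. X \<in> subsets_of_card M n \<Longrightarrow> bij_betw (m X) X (pverts D)"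
    and m_N: "\<And>i s. i < v \<Longrightarrow> s \<in> N i \<Longrightarrow> m (T i) (\<sigma> s) = e (nbr i (\<sigma> s))"
    using T_in by metis
  define D' where "D' = blowup D M m"
  have D': "descartes (Suc k) D'"
    using descartes_blowup[OF D] m unfolding D'_def M_def n_def by blast
  \<comment> \<open>Although \<open>e\<close> places all components in one \<open>D\<close>, each
    goes to its own copy: a vertex of \<open>S\<close> may have neighbours in several components but
    has at most one in each copy.\<close>
  define f where "f x = (if x \<in> S then \<sigma> x else copy_vertex M (T (c x)) (e x))" for x
  have \<sigma>_M: "\<sigma> s < M" if "s \<in> S" for s using \<sigma>_less[OF that] M by (simp add: v_def)
  have T_c: "T (c x) \<in> subsets_of_card M (card (pverts D))" if "x \<in> V - S" for x
    using T_in c_less that by (simp add: n_def)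
  have matching: "\<sigma> s \<in> T (c x) \<and> m (T (c x)) (\<sigma> s) = e x \<longleftrightarrow> (s, x) \<in> E"
    if "s \<in> S" "x \<in> V - S" for s x
  proof
    assume "(s, x) \<in> E"
    then have "s \<in> N (c x)" using that by (auto simp: N_def)
    then show "\<sigma> s \<in> T (c x) \<and> m (T (c x)) (\<sigma> s) = e x"
      using m_N[OF c_less] nbr[OF that(2) refl that(1) \<open>(s, x) \<in> E\<close>] that by (simp add: T_def)
  next
    assume *: "\<sigma> s \<in> T (c x) \<and> m (T (c x)) (\<sigma> s) = e x"
    \<comment> \<open>Since \<open>\<sigma> s < v\<close>, it is not a filler, so \<open>s\<close>
      has a neighbour \<open>u\<close> in the component of \<open>x\<close>; the prescribed matching
      and injectivity of \<open>e\<close> then give \<open>u = x\<close>.\<close>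
    then have "\<sigma> s \<in> \<sigma> ` N (c x)" using T_mem_less \<sigma>_less that by blast
    then have sN: "s \<in> N (c x)" using \<sigma>_eq N_sub that by blast
    then obtain u where u: "u \<in> V - S" "(s, u) \<in> E" "nbr (c x) (\<sigma> s) = u" using N_nbr by blast
    then have "e u = e x" using m_N[OF c_less sN] that * by simp
    then have "u = x" using e_inj[of u x] u(1) that(2) by blast
    then show "(s, x) \<in> E" using u(2) by simp
  qed
  have "embedding f E V (parcs D') (pverts D')"
    unfolding embedding_def
  proof (intro conjI ballI)
    show "inj_on f V"
    proof (rule inj_onI)
      fix x y assume xy: "x \<in> V" "y \<in> V" "f x = f y"
      have ne: "\<sigma> s \<noteq> copy_vertex M X z" if "s \<in> S" for s X z
        using \<sigma>_M[OF that] by (metis copy_vertex_not_less)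
      show "x = y"
      proof (cases "x \<in> S \<longleftrightarrow> y \<in> S")
        case True
        then show ?thesis
          using xy \<sigma>_eq copy_vertex_eq_iff[OF T_c T_c, of x y] e_inj
          by (auto simp: f_def split: if_splits)
      next
        case False
        then show ?thesis using xy ne by (metis f_def)
      qed
    qed
    show "f ` V \<subseteq> pverts D'"
      using T_c e_mem \<sigma>_M by (force simp: f_def D'_def blowup_def relabel_def Let_def)
    fix x y assume xy: "x \<in> V" "y \<in> V"
    show "(x, y) \<in> E \<longleftrightarrow> (f x, f y) \<in> parcs D'"
    proof (cases "x \<in> S"; cases "y \<in> S")
      assume "x \<in> S" "y \<in> S"
      then show ?thesis using S_stable \<sigma>_M by (simp add: f_def D'_def blowup_arc_base)
    next
      assume "x \<in> S" "y \<notin> S"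
      then show ?thesis
        using blowup_arc_matching(1)[OF \<sigma>_M T_c] matching xy by (simp add: f_def D'_def)
    next
      assume "x \<notin> S" "y \<in> S"
      moreover have "(x, y) \<in> E \<longleftrightarrow> (y, x) \<in> E" using sym by (auto dest: symD)
      ultimately show ?thesis
        using blowup_arc_matching(2)[OF \<sigma>_M T_c] matching xy by (simp add: f_def D'_def)
    next
      assume "x \<notin> S" "y \<notin> S"
      moreover from this have "(x, y) \<in> E \<longleftrightarrow> (e x, e y) \<in> parcs D"
        using e xy by (simp add: embedding_def)
      \<comment> \<open>Lying in the same copy means \<open>c x = c y\<close> by
        \<open>T_inj\<close>, and \<open>c_adj\<close> shows that arcs of \<open>E\<close> never
        join different components.\<close>
      ultimately show ?thesis
        using blowup_arc_copy[OF T_c T_c] T_inj c_adj xy by (auto simp: f_def D'_def)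
    qed
  qed
  then show ?thesis using that D' by blast
qed

lemma hereditarily_split_imp_embedding:
  assumes "finite V" "sym E" "hereditarily_split E V"
  shows "\<exists>k D f. descartes k D \<and> embedding f E V (parcs D) (pverts D)"
  using assms(1,3)
proof (induction V rule: finite_psubset_induct)
  case (psubset V)
  show ?case
  proof (cases "V = {}")
    \<comment> \<open>The empty set is reached when a splitting set exhausts \<open>V\<close>; the
      one-vertex graph then serves.\<close>
    case True
    then have "embedding f E V E' V'" for f :: "'a \<Rightarrow> nat" and E' V' by (simp add: embedding_def)
    then show ?thesis using descartes.one by blast
  next
    case False
    with psubset.prems obtain S where S: "S \<noteq> {}" "splits E V S"
      by (auto simp: hereditarily_split_def)
    then have sub: "V - S \<subset> V" unfolding splits_def by blast
    moreover have "hereditarily_split E (V - S)"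
      using psubset.prems by (auto simp: hereditarily_split_def)
    ultimately obtain k D f where D: "descartes k D" "embedding f E (V - S) (parcs D) (pverts D)"
      using psubset.IH by blast
    define v where "v = card V"
    \<comment> \<open>Raising by \<open>2 * v + 2\<close> gives \<open>n > v\<close> and
      \<open>n \<ge> 2\<close>. The factor 2 pays for \<open>n - 1\<close> in place of
      \<open>n\<close>: as \<open>n \<le> 2 * (n - 1)\<close>, the base size exceeds
      \<open>(v + 1) * n\<close>, hence \<open>v + n * v\<close>.\<close>
    obtain D' g where D': "descartes (k + (2 * v + 2)) D'"
      "embedding g (parcs D) (pverts D) (parcs D') (pverts D')"
      "2 * v + 2 + card (pverts D) \<le> card (pverts D')"
      using descartes_arbitrarily_large[OF D(1)] by blast
    define n where "n = card (pverts D')"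
    have "v < n" "2 \<le> n" using D'(3) by (auto simp: n_def)
    have "v + n * v \<le> (v + 1) * n" using \<open>v < n\<close> by (simp add: algebra_simps)
    also have "\<dots> \<le> (v + 1) * (2 * (n - 1))" using \<open>2 \<le> n\<close> by (intro mult_le_mono2) simp
    also have "\<dots> = (2 * v + 2) * (n - 1)" by simp
    also have "\<dots> \<le> (k + (2 * v + 2)) * (n - 1)" by (intro mult_le_mono1) simp
    finally have "v + n * v \<le> (k + (2 * v + 2)) * (n - 1) + 1" by simp
    then show ?thesis
      using splits_embedding[OF D'(1) \<open>finite V\<close> \<open>sym E\<close> S(2) embedding_comp[OF D(2) D'(2)] n_def _ refl]
        \<open>v < n\<close> unfolding v_def by metis
  qed
qed

theorem theorem10:
  fixes G :: "'a pair_pre_digraph"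
  assumes "pair_graph G"
    and "pverts G \<noteq> {}"
  shows "blanche_descartes G \<longleftrightarrow>
    (\<forall>H. induced_subgraph H (with_proj G) \<and> verts H \<noteq> {} \<longrightarrow>
      (\<exists>S. S \<noteq> {} \<and> strongly_splitting H S))"
proof -
  interpret pair_graph G by fact
  have wf: "wf_digraph (with_proj G)" ..
  \<comment> \<open>\<open>hereditarily_split\<close> mediates: it is pulled back along the
    isomorphism in one direction and yields an embedding in the other.\<close>
  have "blanche_descartes G \<longleftrightarrow> hereditarily_split (parcs G) (pverts G)"
  proof
    assume "blanche_descartes G"
    then obtain k D H where D: "descartes k D" and H: "induced_subgraph H (with_proj D)"
      and GH: "digraph_iso (with_proj G) H"
      unfolding blanche_descartes_def by blast
    obtain f where "embedding f (parcs G) (pverts G) (arcs_ends H) (verts H)"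
      using embedding_of_digraph_iso[OF GH] by blast
    then show "hereditarily_split (parcs G) (pverts G)"
      using embedding_into_induced[OF H] hereditarily_split_embedding descartes_hereditarily_split[OF D]
      by blast
  next
    assume "hereditarily_split (parcs G) (pverts G)"
    moreover have "sym (parcs G)" using pair_sym_arcs by (simp add: symmetric_def)
    ultimately obtain k D f where D: "descartes k D"
      and f: "embedding f (parcs G) (pverts G) (parcs D) (pverts D)"
      using hereditarily_split_imp_embedding[OF pair_finite_verts] by blast
    interpret D: wf_digraph "with_proj D" using descartes_wf[OF D] by blast
    have "induced_subgraph (with_proj D \<restriction> f ` pverts G) (with_proj D)"
      using f by (intro D.induced_induce) (auto simp: embedding_def)
    moreover have "digraph_iso (with_proj G) (with_proj D \<restriction> f ` pverts G)"
      using digraph_iso_relabel[OF _ wf, of f] f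
      unfolding relabel_embedding[OF f wf] by (simp add: embedding_def)
    moreover have "k \<ge> 1" using descartes_pos[OF D] by simp
    ultimately show "blanche_descartes G"
      unfolding blanche_descartes_def using D assms(2)
      by (metis image_is_empty induce_subgraph_verts)
  qed
  then show ?thesis
    by (simp only: all_induced_strongly_splitting_iff)
qed

end
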